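(* Let $n\ge 3$ and let $1\le k\le n$ be an integer which does not divide $n$. Then $\gamma_{\mathbb G_n}(0;e_k)>\rho_n(e_k)$. In particular, for every $n\ge 3$ one has $c_{\mathbb G_n}(0,\cdot)\neq p_{\mathbb G_n}(0,\cdot)$ (as functions on $\mathbb G_n$).
   Context: $\mathbb D$ is the open unit disc in $\mathbb C$, $\mathbb T=\partial\mathbb D$, and $\mathcal O(D,\mathbb D)$ is the set of holomorphic maps $D\to\mathbb D$. Let $\sigma_n=(\sigma_{n,1},\dots,\sigma_{n,n}):\mathbb C^n\to\mathbb C^n$, $\sigma_{n,k}(z_1,\dots,z_n)=\sum_{1\le j_1<\dots<j_k\le n}z_{j_1}\cdots z_{j_k}$, $1\le k\le n$. The symmetrized $n$-disc is the domain $\mathbb G_n=\sigma_n(\mathbb D^n)\subset\mathbb C^n$. Let $e_1,\dots,e_n$ be the standard basis of $\mathbb C^n$. For a domain $D\subset\mathbb C^n$, $z,w\in D$, $X\in\mathbb C^n$: the Carathéodory pseudodistance is $c_D(z,w)=\sup\{\tanh^{-1}|f(w)|: f\in\mathcal O(D,\mathbb D), f(z)=0\}$, and the Carathéodory–Reiffen pseudometric is $\gamma_D(z;X)=\sup\{|f'(z)X|: f\in\mathcal O(D,\mathbb D), f(z)=0\}$. For $X=\sum_{j=1}^nX_je_j\in\mathbb C^n$ put $\rho_n(X)=\max_{\lambda\in\mathbb T}\left|\frac{1}{n}\sum_{j=1}^n jX_j\lambda^{j-1}\right|$. For $\lambda\in\overline{\mathbb D}$ and $m\ge 2$ define the rational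 map $p_{m,\lambda}(z)=(\tilde z_1(\lambda),\dots,\tilde z_{m-1}(\lambda))\in\mathbb C^{m-1}$ for $z\in\mathbb C^m$ with $m+\lambda z_1\ne 0$, where $\tilde z_j(\lambda)=\frac{(m-j)z_j+\lambda(j+1)z_{j+1}}{m+\lambda z_1}$, $1\le j\le m-1$. For $\lambda_1,\dots,\lambda_{n-1}\in\overline{\mathbb D}$ put $f_{\lambda_1,\dots,\lambda_{n-1}}=p_{2,\lambda_1}\circ\dots\circ p_{n,\lambda_{n-1}}$; this maps $\mathbb G_n$ holomorphically into $\mathbb D$. For $z,w\in\mathbb G_n$ put $p_{\mathbb G_n}(z,w)=\max_{\lambda_1,\dots,\lambda_{n-1}\in\mathbb T}p_{\mathbb D}(f_{\lambda_1,\dots,\lambda_{n-1}}(z),f_{\lambda_1,\dots,\lambda_{n-1}}(w))$, where $p_{\mathbb D}(a,b)=\tanh^{-1}\left|\frac{a-b}{1-\overline{a}b}\right|$ is the Poincaré distance on $\mathbb D$. *)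

theory Defs
  imports "HOL-Analysis.Analysis"
begin

text \<open>
  The space \<open>\<complex>\<^sup>n\<close> is \<^typ>\<open>complex ^ 'n\<close> over a finite linearly ordered index type of cardinality
  \<open>n\<close>; the order numbers the coordinates \<open>1, \<dots>, n\<close>.
\<close>

definition pos :: "'n::{finite,linorder} \<Rightarrow> nat" where
  "pos i = card {..i}"

definition idx :: "nat \<Rightarrow> 'n::{finite,linorder}" where
  "idx = the_inv pos"

lemma pos_strict_mono: "strict_mono (pos :: 'n::{finite,linorder} \<Rightarrow> nat)"
  unfolding pos_def by (intro strict_monoI psubset_card_mono) auto

lemma inj_pos: "inj (pos :: 'n::{finite,linorder} \<Rightarrow> nat)"
  using pos_strict_mono by (rule strict_mono_imp_inj_on)

lemma bij_betw_pos: "bij_betw pos (UNIV :: 'n::{finite,linorder} set) {1..CARD('n)}"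
proof -
  have "pos i \<in> {1..CARD('n)}" for i :: 'n
  proof -
    have "0 < card {..i}" by (subst card_gt_0_iff) auto
    moreover have "card {..i} \<le> CARD('n)" by (intro card_mono) auto
    ultimately show ?thesis by (auto simp: pos_def simp del: card_eq_0_iff)
  qed
  then have "range (pos :: 'n \<Rightarrow> nat) \<subseteq> {1..CARD('n)}" by blast
  moreover have "card (range (pos :: 'n \<Rightarrow> nat)) = card {1..CARD('n)}"
    using card_image[OF inj_pos] by simp
  ultimately have "range (pos :: 'n \<Rightarrow> nat) = {1..CARD('n)}"
    by (intro card_subset_eq) auto
  with inj_pos show ?thesis by (simp add: bij_betw_def)
qed

lemma idx_pos [simp]: "idx (pos i) = i"
  unfolding idx_def by (rule the_inv_f_f[OF inj_pos])

lemma pos_idx: "1 \<le> j \<Longrightarrow> j \<le> CARD('n) \<Longrightarrow> pos (idx j :: 'n::{finite,linorder}) = j"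
  using bij_betw_pos[where 'n = 'n] unfolding idx_def
  by (intro f_the_inv_into_f inj_pos) (auto simp: bij_betw_def)

definition coord :: "complex ^ 'n::{finite,linorder} \<Rightarrow> nat \<Rightarrow> complex" where
  "coord z j = (if j \<in> {1..CARD('n)} then z $ idx j else 0)"

definition std_basis :: "nat \<Rightarrow> complex ^ 'n::{finite,linorder}" where
  "std_basis k = axis (idx k) 1"

definition polydisc :: "(complex ^ 'n) set" where
  "polydisc = {z. \<forall>i. z $ i \<in> ball 0 1}"

definition symmetrization :: "complex ^ 'n::{finite,linorder} \<Rightarrow> complex ^ 'n::{finite,linorder}" where
  "symmetrization z = (\<chi> i. \<Sum>S | card S = pos i. \<Prod>j\<in>S. z $ j)"

definition symdisc :: "(complex ^ 'n::{finite,linorder}) set" where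
  "symdisc = symmetrization ` polydisc"

text \<open>Holomorphy in several variables: existence of a complex-linear Frechet derivative.\<close>

definition holomorphic_maps :: "(complex ^ 'n) set \<Rightarrow> complex set \<Rightarrow> (complex ^ 'n \<Rightarrow> complex) set" where
  "holomorphic_maps D E =
    {f. f ` D \<subseteq> E \<and>
        (\<forall>z\<in>D. \<exists>f'. (f has_derivative f') (at z) \<and> (\<forall>a v. f' (a *s v) = a * f' v))}"

text \<open>The suprema are taken in the extended reals, so that no boundedness is presupposed.\<close>

definition caratheodory_dist ::
    "(complex ^ 'n) set \<Rightarrow> complex ^ 'n \<Rightarrow> complex ^ 'n \<Rightarrow> ereal" where
  "caratheodory_dist D z w =
    (SUP f \<in> {f \<in> holomorphic_maps D (ball 0 1). f z = 0}. ereal (artanh (cmod (f w))))"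

definition caratheodory_reiffen ::
    "(complex ^ 'n) set \<Rightarrow> complex ^ 'n \<Rightarrow> complex ^ 'n \<Rightarrow> ereal" where
  "caratheodory_reiffen D z X =
    (SUP f \<in> {f \<in> holomorphic_maps D (ball 0 1). f z = 0}.
       ereal (cmod (frechet_derivative f (at z) X)))"

definition rho :: "complex ^ 'n::{finite,linorder} \<Rightarrow> real" where
  "rho X = (SUP l \<in> sphere 0 1.
     cmod (1 / of_nat CARD('n) * (\<Sum>j=1..CARD('n). of_nat j * coord X j * l ^ (j - 1))))"

text \<open>
  Since the maps below change the dimension, their arguments \<open>z \<in> \<complex>\<^sup>m\<close> are sequences of which
  only the entries \<open>1, \<dots>, m\<close> are used.
\<close>

definition p_map :: "nat \<Rightarrow> complex \<Rightarrow> (nat \<Rightarrow> complex) \<Rightarrow> (nat \<Rightarrow> complex)" where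
  "p_map m l z = (\<lambda>j. if j \<in> {1..m - 1}
     then (of_nat (m - j) * z j + l * of_nat (j + 1) * z (j + 1)) / (of_nat m + l * z 1)
     else 0)"

text \<open>\<open>p_comp l r = p_map 2 (l 1) \<circ> \<dots> \<circ> p_map (r + 1) (l r)\<close>, a map from \<open>\<complex>\<^sup>m\<close> to \<open>\<complex>\<close> for \<open>m = r + 1\<close>.\<close>

primrec p_comp :: "(nat \<Rightarrow> complex) \<Rightarrow> nat \<Rightarrow> (nat \<Rightarrow> complex) \<Rightarrow> (nat \<Rightarrow> complex)" where
  "p_comp l 0 = id"
| "p_comp l (Suc r) = p_comp l r \<circ> p_map (r + 2) (l (Suc r))"

definition f_map :: "(nat \<Rightarrow> complex) \<Rightarrow> complex ^ 'n::{finite,linorder} \<Rightarrow> complex" where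
  "f_map l z = p_comp l (CARD('n) - 1) (coord z) 1"

definition poincare_dist :: "complex \<Rightarrow> complex \<Rightarrow> real" where
  "poincare_dist a b = artanh (cmod ((a - b) / (1 - cnj a * b)))"

definition p_dist :: "complex ^ 'n::{finite,linorder} \<Rightarrow> complex ^ 'n::{finite,linorder} \<Rightarrow> real" where
  "p_dist z w = (SUP l \<in> {1..CARD('n) - 1} \<rightarrow>\<^sub>E sphere 0 1. poincare_dist (f_map l z) (f_map l w))"

end

theory Submission
  imports Defs "HOL-Computational_Algebra.Formal_Power_Series"
begin

text \<open>
  Let \<open>p\<^sub>j\<close> be the \<open>j\<close>-th power sum of \<open>- z\<close>, a polynomial in the elementary symmetric functions
  by Newton's identities. On the closed polydisc \<open>\<bar>p\<^sub>k\<bar> \<le> n\<close>, with equality only if all \<open>(- z\<^sub>i)\<^sup>k\<close>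
  equal one unimodular number. At such points \<open>cnj p\<^sub>k * Q = n * (\<Sum>j. \<bar>p\<^sub>j\<bar>\<^sup>2)\<close> for the sum \<open>Q\<close> of the
  products of \<open>p\<^sub>j\<close> and \<open>p\<^sub>i\<close> with \<open>i + j = k\<close>, \<open>1 \<le> j < k\<close>; this is positive, because the vanishing of
  all these \<open>p\<^sub>j\<close> would force \<open>k\<close> to divide \<open>n\<close>. By compactness \<open>\<bar>p\<^sub>k - \<epsilon> Q\<bar> < s < n\<close> for some small \<open>\<epsilon>\<close>.
  As \<open>Q\<close> has no linear part, \<open>(p\<^sub>k - \<epsilon> Q) / s\<close> has derivative \<open>- k / s\<close> at \<open>0\<close> along \<open>e\<^sub>k\<close>, of modulus
  greater than \<open>k / n\<close>.

  For the distances, symmetrizing multiples of the \<open>k\<close>-th roots of unity gives small points \<open>a e\<^sub>k\<close>.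
  There the new function has modulus exactly \<open>k \<bar>a\<bar> / s\<close>, while the maps \<open>f_map l\<close> are bounded by
  \<open>N / (1 - (n - 1) N)\<close> with \<open>N = k \<bar>a\<bar> / n\<close>, uniformly in \<open>l\<close>.
\<close>

section \<open>Generating functions, power sums and Newton's identities\<close>

lemma fps_const_prod: "(\<Prod>i\<in>S. fps_const (f i :: 'a::comm_ring_1)) = fps_const (\<Prod>i\<in>S. f i)"
  by (induction S rule: infinite_finite_induct) auto

text \<open>Picking the linear term of the factors in \<open>S\<close> and 1 elsewhere contributes
  to degree \<open>card S\<close>. The product is thus the generating function of the elementary
  symmetric functions.\<close>

lemma fps_nth_prod_one_plus_X:
  fixes z :: "'i \<Rightarrow> 'a::comm_ring_1"
  assumes "finite A"
  shows "fps_nth (\<Prod>i\<in>A. 1 + fps_const (z i) * fps_X) k = (\<Sum>S | S \<subseteq> A \<and> card S = k. \<Prod>j\<in>S. z j)"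
proof -
  have "(\<Prod>i\<in>A. 1 + fps_const (z i) * fps_X) = (\<Prod>i\<in>A. fps_const (z i) * fps_X + 1)"
    by (simp add: add.commute)
  also have "\<dots> = (\<Sum>S\<in>Pow A. (\<Prod>i\<in>S. fps_const (z i) * fps_X) * (\<Prod>i\<in>A - S. 1))"
    using assms by (rule prod_add)
  also have "\<dots> = (\<Sum>S\<in>Pow A. fps_const (\<Prod>i\<in>S. z i) * fps_X ^ card S)"
    by (simp add: prod.distrib fps_const_prod)
  also have "fps_nth \<dots> k = (\<Sum>S\<in>Pow A. if card S = k then \<Prod>i\<in>S. z i else 0)"
    unfolding fps_sum_nth by (intro sum.cong) (auto simp: fps_X_power_nth)
  also have "\<dots> = (\<Sum>S | S \<subseteq> A \<and> card S = k. \<Prod>j\<in>S. z j)"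
    using assms by (subst sum.inter_filter [symmetric]) (auto simp: Pow_def)
  finally show ?thesis .
qed

text \<open>This is the logarithmic derivative: each factor contributes
  \<open>z / (1 + z X)\<close>, a geometric series in \<open>- z\<close>. Induction over the factors
  avoids any division.\<close>

lemma fps_deriv_prod_one_plus_X:
  fixes z :: "'i \<Rightarrow> 'a::comm_ring_1"
  assumes "finite A"
  shows "fps_deriv (\<Prod>i\<in>A. 1 + fps_const (z i) * fps_X) =
    - ((\<Prod>i\<in>A. 1 + fps_const (z i) * fps_X) * Abs_fps (\<lambda>k. \<Sum>i\<in>A. (- z i) ^ Suc k))"
  using assms
proof (induction A)
  case empty
  then show ?case by (simp add: fps_eq_iff)
next
  case (insert a A)
  let ?E = "\<Prod>i\<in>A. 1 + fps_const (z i) * fps_X" and ?f = "1 + fps_const (z a) * fps_X"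
  let ?p = "Abs_fps (\<lambda>k. \<Sum>i\<in>A. (- z i) ^ Suc k)" and ?q = "Abs_fps (\<lambda>k. (- z a) ^ Suc k)"
  have q: "?f * ?q = - fps_const (z a)"
  proof (rule fps_ext)
    fix k show "fps_nth (?f * ?q) k = fps_nth (- fps_const (z a)) k"
      by (cases k) (simp_all add: distrib_right mult.assoc)
  qed
  have split: "Abs_fps (\<lambda>k. \<Sum>i\<in>insert a A. (- z i) ^ Suc k) = ?q + ?p"
    using insert by (simp add: fps_eq_iff)
  have "fps_deriv (?f * ?E) = fps_const (z a) * ?E + ?f * fps_deriv ?E"
    by (simp add: algebra_simps)
  also have "\<dots> = - (?f * ?q) * ?E - ?f * ?E * ?p"
    unfolding insert.IH q by (simp add: algebra_simps)
  also have "\<dots> = - (?f * ?E * (?q + ?p))"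
    by (simp add: algebra_simps)
  finally show ?case
    unfolding split prod.insert [OF insert.hyps] .
qed

text \<open>In terms of \<open>x = - z\<close> Newton's identities carry no alternating signs.\<close>

lemma newton_identity:
  fixes z :: "'i \<Rightarrow> 'a::comm_ring_1"
  defines "e \<equiv> \<lambda>A k. \<Sum>S | S \<subseteq> A \<and> card S = k. \<Prod>j\<in>S. z j"
  assumes "finite A"
  shows "of_nat (Suc k) * e A (Suc k) = - (\<Sum>j=0..k. e A j * (\<Sum>i\<in>A. (- z i) ^ Suc (k - j)))"
  using arg_cong [OF fps_deriv_prod_one_plus_X [OF assms(2), of z], of "\<lambda>f. fps_nth f k"]
  by (simp add: fps_mult_nth fps_nth_prod_one_plus_X [OF assms(2)] e_def del: power_Suc of_nat_Suc)

text \<open>Newton's identities solved for the power sum, so that it becomes a polynomial in the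
  coordinates of a point of the symmetrized disc.\<close>

fun newton_psum :: "(nat \<Rightarrow> 'a::comm_ring_1) \<Rightarrow> nat \<Rightarrow> 'a" where
  "newton_psum w k = - of_nat k * w k - (\<Sum>j\<in>{1..<k}. w (k - j) * newton_psum w j)"

declare newton_psum.simps [simp del]

lemma coord_symmetrization:
  fixes z :: "complex ^ 'n::{finite,linorder}"
  assumes "1 \<le> j" "j \<le> CARD('n::{finite,linorder})"
  shows "coord (symmetrization z) j = (\<Sum>S | card S = j. \<Prod>i\<in>S. z $ i)"
  using assms by (simp add: coord_def symmetrization_def pos_idx)

lemma newton_psum_symmetrization:
  fixes z :: "complex ^ 'n::{finite,linorder}"
  assumes "1 \<le> k" "k \<le> CARD('n::{finite,linorder})"
  shows "newton_psum (coord (symmetrization z)) k = (\<Sum>i\<in>UNIV. (- z $ i) ^ k)"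
  using assms
proof (induction k rule: less_induct)
  case (less k)
  define e where "e j = (\<Sum>S | card S = j. \<Prod>i\<in>S. z $ i)" for j
  define p where "p j = (\<Sum>i\<in>UNIV. (- z $ i) ^ j)" for j
  obtain m where m: "k = Suc m" using less.prems by (cases k) auto
  have "{S::'n set. card S = 0} = {{}}" by auto
  then have e0: "e 0 = 1" by (simp add: e_def)
  have "of_nat k * e k = - (\<Sum>j=0..m. e j * p (Suc (m - j)))"
    using newton_identity [of UNIV m "($) z"] by (simp add: m e_def p_def)
  \<comment> \<open>Since \<open>e 0 = 1\<close>, the term \<open>j = 0\<close> is the power sum to
    be solved for.\<close>
  also have "(\<Sum>j=0..m. e j * p (Suc (m - j))) = p k + (\<Sum>j\<in>{1..m}. e j * p (Suc (m - j)))"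
    by (subst sum.atLeast_Suc_atMost) (auto simp: e0 m)
  also have "(\<Sum>j\<in>{1..m}. e j * p (Suc (m - j))) = (\<Sum>j\<in>{1..<k}. e (k - j) * p j)"
    by (rule sum.reindex_bij_witness [of _ "\<lambda>j. k - j" "\<lambda>j. k - j"]) (auto simp: m Suc_diff_le)
  also have "\<dots> = (\<Sum>j\<in>{1..<k}. coord (symmetrization z) (k - j) * newton_psum (coord (symmetrization z)) j)"
    using less.prems by (intro sum.cong refl) (auto simp: less.IH coord_symmetrization e_def p_def)
  finally show ?case
    using less.prems by (subst newton_psum.simps) (simp add: coord_symmetrization e_def p_def)
qed

section \<open>Derivatives and holomorphy of the power sum polynomials\<close>

lemma has_derivative_coord: "((\<lambda>w. coord w j) has_derivative (\<lambda>v. coord v j)) F"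
  unfolding coord_def by (cases "j \<in> {1..CARD('a)}") (auto intro!: bounded_linear_imp_has_derivative)

lemma coord_0: "coord 0 j = 0"
  by (simp add: coord_def)

lemma newton_psum_coord_0: "newton_psum (coord 0) k = 0"
  by (subst newton_psum.simps) (simp add: coord_0)

text \<open>Both factors of each product in the recursion vanish at 0, so only the linear term
  contributes.\<close>

lemma has_derivative_newton_psum_0:
  "((\<lambda>w. newton_psum (coord w) k) has_derivative
     (\<lambda>v. - of_nat k * coord v k)) (at (0 :: complex ^ 'n::{finite,linorder}))"
proof (induction k rule: less_induct)
  case (less k)
  have "((\<lambda>w :: complex ^ 'n::{finite,linorder}. - of_nat k * coord w k - (\<Sum>j\<in>{1..<k}. coord w (k - j) * newton_psum (coord w) j))
     has_derivative (\<lambda>v. - of_nat k * coord v k -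
       (\<Sum>j\<in>{1..<k}. coord (0 :: complex ^ 'n::{finite,linorder}) (k - j) * (- of_nat j * coord v j) +
         coord v (k - j) * newton_psum (coord (0 :: complex ^ 'n::{finite,linorder})) j))) (at 0)"
    by (intro has_derivative_diff has_derivative_sum has_derivative_mult has_derivative_mult_right
          has_derivative_coord less.IH) auto
  then show ?case
    by (subst newton_psum.simps) (simp add: coord_0 newton_psum_coord_0)
qed

text \<open>The pointwise condition of \<open>holomorphic_maps\<close>, isolated to prove its
  closure under arithmetic.\<close>

definition complex_differentiable :: "(complex ^ 'n \<Rightarrow> complex) \<Rightarrow> complex ^ 'n \<Rightarrow> bool" where
  "complex_differentiable f z \<longleftrightarrow> (\<exists>f'. (f has_derivative f') (at z) \<and> (\<forall>a v. f' (a *s v) = a * f' v))"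

lemma complex_differentiable_const: "complex_differentiable (\<lambda>w. c) z"
  unfolding complex_differentiable_def by (rule exI [of _ "\<lambda>v. 0"]) auto

lemma complex_differentiable_coord: "complex_differentiable (\<lambda>w. coord w j) z"
  unfolding complex_differentiable_def
  by (rule exI [of _ "\<lambda>v. coord v j"]) (auto simp: has_derivative_coord, auto simp: coord_def)

lemma complex_differentiable_diff:
  assumes "complex_differentiable f z" "complex_differentiable g z"
  shows "complex_differentiable (\<lambda>w. f w - g w) z"
proof -
  obtain f' g' where "(f has_derivative f') (at z)" "\<And>a v. f' (a *s v) = a * f' v"
    "(g has_derivative g') (at z)" "\<And>a v. g' (a *s v) = a * g' v"
    using assms by (auto simp: complex_differentiable_def)
  then show ?thesis
    unfolding complex_differentiable_def
    by (intro exI [of _ "\<lambda>v. f' v - g' v"]) (auto intro: has_derivative_diff simp: algebra_simps)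
qed

lemma complex_differentiable_mult:
  assumes "complex_differentiable f z" "complex_differentiable g z"
  shows "complex_differentiable (\<lambda>w. f w * g w) z"
proof -
  obtain f' g' where "(f has_derivative f') (at z)" "\<And>a v. f' (a *s v) = a * f' v"
    "(g has_derivative g') (at z)" "\<And>a v. g' (a *s v) = a * g' v"
    using assms by (auto simp: complex_differentiable_def)
  then show ?thesis
    unfolding complex_differentiable_def
    by (intro exI [of _ "\<lambda>v. f z * g' v + f' v * g z"]) (auto intro: has_derivative_mult simp: algebra_simps)
qed

lemma complex_differentiable_sum:
  assumes "\<And>i. i \<in> I \<Longrightarrow> complex_differentiable (f i) z"
  shows "complex_differentiable (\<lambda>w. \<Sum>i\<in>I. f i w) z"
proof -
  obtain f' where f': "\<And>i. i \<in> I \<Longrightarrow> (f i has_derivative f' i) (at z)"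
    "\<And>i a v. i \<in> I \<Longrightarrow> f' i (a *s v) = a * f' i v"
    using assms unfolding complex_differentiable_def by metis
  then show ?thesis
    unfolding complex_differentiable_def
    by (intro exI [of _ "\<lambda>v. \<Sum>i\<in>I. f' i v"]) (auto intro!: has_derivative_sum simp: sum_distrib_left)
qed

lemma complex_differentiable_newton_psum:
  "complex_differentiable (\<lambda>w. newton_psum (coord w) k) z"
proof (induction k rule: less_induct)
  case (less k)
  have "complex_differentiable
      (\<lambda>w. - of_nat k * coord w k - (\<Sum>j\<in>{1..<k}. coord w (k - j) * newton_psum (coord w) j)) z"
    by (intro complex_differentiable_diff complex_differentiable_sum complex_differentiable_mult
        complex_differentiable_const complex_differentiable_coord less.IH) simp
  then show ?case
    by (subst newton_psum.simps)
qed

section \<open>Maximum points of the power sums\<close>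

text \<open>The equality case of the triangle inequality. After rotation by the conjugate of the
  mean \<open>u\<close>, the real parts are at most 1 and sum to \<open>card A\<close>, so each is
  1.\<close>

lemma norm_sum_eq_card_imp_eq:
  fixes x :: "'i \<Rightarrow> complex"
  assumes "finite A" "A \<noteq> {}" "\<And>i. i \<in> A \<Longrightarrow> cmod (x i) \<le> 1" "cmod (\<Sum>i\<in>A. x i) = card A"
  obtains u where "cmod u = 1" "\<And>i. i \<in> A \<Longrightarrow> x i = u"
proof -
  define u where "u = (\<Sum>i\<in>A. x i) / of_nat (card A)"
  have card: "card A > 0" using assms by (simp add: card_gt_0_iff)
  then have u: "cmod u = 1" using assms by (simp add: u_def norm_divide)
  then have cu: "cnj u * u = 1" by (metis complex_norm_square mult.commute of_real_1 power_one)
  have le: "Re (cnj u * x i) \<le> 1" if "i \<in> A" for i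
    using complex_Re_le_cmod [of "cnj u * x i"] assms(3) [OF that] u by (simp add: norm_mult)
  have "(\<Sum>i\<in>A. cnj u * x i) = of_nat (card A) * (cnj u * u)"
    using card unfolding sum_distrib_left [symmetric] by (simp add: u_def)
  then have "(\<Sum>i\<in>A. Re (cnj u * x i)) = of_nat (card A)"
    unfolding cu by (simp only: Re_sum [symmetric]) simp
  then have "(\<Sum>i\<in>A. 1 - Re (cnj u * x i)) = 0"
    by (simp add: sum_subtractf)
  then have eq: "Re (cnj u * x i) = 1" if "i \<in> A" for i
    using that le assms(1) by (subst (asm) sum_nonneg_eq_0_iff) auto
  have "x i = u" if "i \<in> A" for i
  proof -
    have n: "cmod (cnj u * x i) \<le> 1" using assms(3) [OF that] u by (simp add: norm_mult)
    have "(cmod (cnj u * x i))\<^sup>2 \<le> 1" using n by (simp add: power_le_one)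
    then have "Im (cnj u * x i) = 0"
      using eq [OF that] by (simp add: cmod_power2)
    then have "cnj u * x i = 1" using eq [OF that] by (simp add: complex_eq_iff)
    then have "cnj u * x i = cnj u * u" using cu by simp
    then show ?thesis using u by auto
  qed
  with u that show thesis by blast
qed

text \<open>Summing the geometric series \<open>(z i / z a) ^ j\<close>, \<open>j < k\<close>, over \<open>i\<close> counts the \<open>i\<close> with \<open>z i = z a\<close>.\<close>

lemma dvd_card_if_power_sums_vanish:
  fixes z :: "'i \<Rightarrow> complex"
  assumes "finite A" "a \<in> A" "z a \<noteq> 0" "k > 0" "\<And>i. i \<in> A \<Longrightarrow> z i ^ k = z a ^ k"
    and "\<And>j. j \<in> {1..<k} \<Longrightarrow> (\<Sum>i\<in>A. z i ^ j) = 0"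
  shows "k dvd card A"
proof -
  have geo: "(\<Sum>j<k. (z i / z a) ^ j) = (if z i = z a then of_nat k else 0)" if "i \<in> A" for i
  proof (cases "z i = z a")
    case False
    then have "z i / z a \<noteq> 1" using assms by simp
    moreover have "(z i / z a) ^ k = 1"
      using assms(3) assms(5) [OF that] by (simp add: power_divide)
    ultimately show ?thesis using False geometric_sum [of "z i / z a" k] by simp
  qed (use assms in simp)
  \<comment> \<open>By the vanishing of the power sums, only \<open>j = 0\<close> survives in the
    double sum, and it counts all of \<open>A\<close>.\<close>
  have "of_nat (card A) = (\<Sum>j<k. if j = 0 then of_nat (card A) else (0::complex))"
    using assms by simp
  also have "\<dots> = (\<Sum>j<k. (\<Sum>i\<in>A. z i ^ j) / z a ^ j)"
    by (intro sum.cong) (auto simp: assms(6))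
  also have "\<dots> = (\<Sum>i\<in>A. \<Sum>j<k. (z i / z a) ^ j)"
    by (subst sum.swap) (simp add: power_divide sum_divide_distrib)
  also have "\<dots> = (\<Sum>i\<in>A. if z i = z a then of_nat k else 0)"
    by (intro sum.cong) (auto simp: geo)
  also have "\<dots> = of_nat (k * card {i\<in>A. z i = z a})"
    using assms(1) by (simp add: sum.inter_filter [symmetric] mult.commute)
  finally have "card A = k * card {i\<in>A. z i = z a}" by (simp only: of_nat_eq_iff)
  then show ?thesis by simp
qed

text \<open>On the torus, equality of all \<open>z i ^ k\<close> turns \<open>p\<^sub>k\<^sub>-\<^sub>j\<close> into a multiple of the conjugate of \<open>p\<^sub>j\<close>.\<close>

lemma psum_correlation_pos:
  fixes z :: "'i \<Rightarrow> complex" and A :: "'i set"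
  defines "p \<equiv> \<lambda>j. \<Sum>i\<in>A. z i ^ j"
  assumes "finite A" "A \<noteq> {}" "k > 0" "\<not> k dvd card A"
    and le: "\<And>i. i \<in> A \<Longrightarrow> cmod (z i) \<le> 1" and max: "cmod (p k) = card A"
  shows "Re (cnj (p k) * (\<Sum>j\<in>{1..<k}. p j * p (k - j))) > 0"
proof -
  obtain u where u: "cmod u = 1" "\<And>i. i \<in> A \<Longrightarrow> z i ^ k = u"
    using norm_sum_eq_card_imp_eq [of A "\<lambda>i. z i ^ k"] assms
    by (auto simp: norm_power power_le_one p_def)
  have cu: "cnj u * u = 1" using u by (metis complex_norm_square mult.commute of_real_1 power_one)
  have z1: "cmod (z i) = 1" if "i \<in> A" for i
  proof -
    have "cmod (z i) ^ k = 1" using u that by (metis norm_power)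
    from power_eq_1_iff [OF this] show ?thesis using \<open>k > 0\<close> by simp
  qed
  have conj: "p (k - j) = u * cnj (p j)" if "j < k" for j
  proof -
    have "z i ^ (k - j) = u * cnj (z i ^ j)" if "i \<in> A" for i
    proof -
      have "z i ^ j * cnj (z i ^ j) = 1"
        using z1 [OF that] complex_norm_square [of "z i ^ j"] by (simp add: norm_power)
      moreover have "u = z i ^ (k - j) * z i ^ j"
        using u(2) [OF that] \<open>j < k\<close> by (simp flip: power_add)
      ultimately show ?thesis by (simp add: mult.assoc)
    qed
    then show ?thesis by (simp add: p_def sum_distrib_left)
  qed
  have pk: "p k = of_nat (card A) * u" by (simp add: p_def u)
  have "(\<Sum>j\<in>{1..<k}. p j * p (k - j)) = (\<Sum>j\<in>{1..<k}. u * of_real ((cmod (p j))\<^sup>2))"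
    by (intro sum.cong refl) (simp add: conj complex_norm_square mult_ac del: of_real_power)
  then have "cnj (p k) * (\<Sum>j\<in>{1..<k}. p j * p (k - j)) = cnj (p k) * (\<Sum>j\<in>{1..<k}. u * of_real ((cmod (p j))\<^sup>2))"
    by simp
  also have "\<dots> = of_nat (card A) * (cnj u * u) * (\<Sum>j\<in>{1..<k}. of_real ((cmod (p j))\<^sup>2))"
    by (simp add: pk mult_ac sum_distrib_left [symmetric])
  also have "\<dots> = of_real (card A * (\<Sum>j\<in>{1..<k}. (cmod (p j))\<^sup>2))"
    by (simp add: cu)
  finally have eq: "Re (cnj (p k) * (\<Sum>j\<in>{1..<k}. p j * p (k - j))) = card A * (\<Sum>j\<in>{1..<k}. (cmod (p j))\<^sup>2)"
    by (simp only: Re_complex_of_real)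
  \<comment> \<open>If every summand vanished, the preceding counting argument would make
    \<open>k\<close> divide \<open>card A\<close>.\<close>
  obtain a where a: "a \<in> A" using \<open>A \<noteq> {}\<close> by auto
  then have "\<not> (\<forall>j\<in>{1..<k}. p j = 0)"
    using dvd_card_if_power_sums_vanish [of A a z k] assms(2-5) u z1 [of a] unfolding p_def by fastforce
  then obtain j where "j \<in> {1..<k}" "p j \<noteq> 0" by blast
  then have "(\<Sum>j\<in>{1..<k}. (cmod (p j))\<^sup>2) > 0"
    by (intro sum_pos2 [of _ j]) auto
  then show ?thesis
    using assms unfolding eq by (simp add: card_gt_0_iff)
qed

section \<open>Compactness and the perturbed power sum\<close>

lemma compact_closed_polydisc: "compact {z :: complex ^ 'n. \<forall>i. cmod (z $ i) \<le> 1}"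
proof -
  have "bounded {z :: complex ^ 'n. \<forall>i. cmod (z $ i) \<le> 1}"
    unfolding bounded_iff
  proof (intro exI ballI)
    fix z :: "complex ^ 'n" assume z: "z \<in> {z. \<forall>i. cmod (z $ i) \<le> 1}"
    have "norm z \<le> (\<Sum>i\<in>UNIV. cmod (z $ i))"
      unfolding norm_vec_def by (rule L2_set_le_sum) auto
    also have "\<dots> \<le> (\<Sum>i\<in>(UNIV :: 'n set). 1)"
      using z by (intro sum_mono) auto
    finally show "norm z \<le> (\<Sum>i\<in>(UNIV :: 'n set). 1)" .
  qed
  moreover have "closed {z :: complex ^ 'n. \<forall>i. cmod (z $ i) \<le> 1}"
    by (intro closed_Collect_all closed_Collect_le continuous_intros)
  ultimately show ?thesis by (simp add: compact_eq_bounded_closed)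
qed

text \<open>
  Near the maximum points of \<open>\<bar>f\<bar>\<close> the perturbation gains to first order in \<open>\<epsilon>\<close>, elsewhere \<open>\<bar>f\<bar>\<close> stays below
  \<open>M\<close> by a fixed margin; the function \<open>h\<close> in the proof treats both cases at once.
\<close>

lemma perturbation_decreases_norm:
  fixes f g :: "'a::topological_space \<Rightarrow> complex"
  assumes "compact K" and cont: "continuous_on K f" "continuous_on K g" and "M > 0"
    and f: "\<And>x. x \<in> K \<Longrightarrow> cmod (f x) \<le> M"
    and fg: "\<And>x. x \<in> K \<Longrightarrow> cmod (f x) = M \<Longrightarrow> Re (cnj (f x) * g x) > 0"
  obtains \<epsilon> s where "0 < s" "s < M" "\<And>x. x \<in> K \<Longrightarrow> cmod (f x - of_real \<epsilon> * g x) < s"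
proof (cases "K = {}")
  case True
  then show ?thesis using that [of "M / 2"] \<open>M > 0\<close> by auto
next
  case False
  define h where "h x = max (M\<^sup>2 - (cmod (f x))\<^sup>2) (Re (cnj (f x) * g x))" for x
  have "continuous_on K h"
    unfolding h_def by (intro continuous_intros cont)
  then obtain x0 where x0: "x0 \<in> K" "\<And>x. x \<in> K \<Longrightarrow> h x0 \<le> h x"
    using continuous_attains_inf [OF \<open>compact K\<close> False] by blast
  define \<eta> where "\<eta> = h x0"
  have \<eta>: "\<eta> > 0"
  proof (cases "cmod (f x0) = M")
    case True
    with fg [OF x0(1)] show ?thesis by (simp add: \<eta>_def h_def less_max_iff_disj)
  next
    case False
    then have "cmod (f x0) < M" using f [OF x0(1)] by simp
    then show ?thesis by (simp add: \<eta>_def h_def less_max_iff_disj power_strict_mono)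
  qed
  obtain B where B: "B > 0" "\<And>x. x \<in> K \<Longrightarrow> cmod (g x) \<le> B"
    using compact_imp_bounded [OF compact_continuous_image [OF cont(2) \<open>compact K\<close>]]
    by (auto simp: bounded_pos)
  \<comment> \<open>The first cap keeps the quadratic term below
    \<open>\<epsilon> * \<eta> / 4\<close>. The second keeps the cross term from adding more than
    \<open>\<eta> / 4\<close>, which the margin \<open>\<eta>\<close> absorbs away from the maximum.
    The third gives \<open>\<epsilon> * \<eta> \<le> \<eta> / 2\<close>.\<close>
  define \<epsilon> where "\<epsilon> = min (\<eta> / (4 * B\<^sup>2)) (min (\<eta> / (8 * M * B)) (1 / 2))"
  have "\<epsilon> \<le> \<eta> / (4 * B\<^sup>2)" "\<epsilon> \<le> \<eta> / (8 * M * B)" "\<epsilon> \<le> 1 / 2" "\<epsilon> > 0"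
    using \<eta> B(1) \<open>M > 0\<close> unfolding \<epsilon>_def by (auto simp del: divide_const_simps)
  then have \<epsilon>: "\<epsilon> > 0" "\<epsilon> * B\<^sup>2 \<le> \<eta> / 4" "\<epsilon> * (M * B) \<le> \<eta> / 8" "\<epsilon> \<le> 1 / 2"
    using B(1) \<open>M > 0\<close> by (auto simp: field_simps)
  have bound: "(cmod (f x - of_real \<epsilon> * g x))\<^sup>2 \<le> M\<^sup>2 - \<epsilon> * \<eta>" if "x \<in> K" for x
  proof -
    define r where "r = Re (cnj (f x) * g x)"
    have expand: "(cmod (f x - of_real \<epsilon> * g x))\<^sup>2 = (cmod (f x))\<^sup>2 - 2 * (\<epsilon> * r) + \<epsilon> * (\<epsilon> * (cmod (g x))\<^sup>2)"
      unfolding r_def cmod_power2 by (simp add: power2_eq_square algebra_simps)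
    have g2: "(cmod (g x))\<^sup>2 \<le> B\<^sup>2" and f2: "(cmod (f x))\<^sup>2 \<le> M\<^sup>2"
      using B(2) [OF that] f [OF that] by (auto intro: power_mono)
    then have "\<epsilon> * (cmod (g x))\<^sup>2 \<le> \<epsilon> * B\<^sup>2" using \<epsilon> by (intro mult_left_mono) auto
    then have "\<epsilon> * (cmod (g x))\<^sup>2 \<le> \<eta> / 4" using \<epsilon>(2) by linarith
    then have small: "\<epsilon> * (\<epsilon> * (cmod (g x))\<^sup>2) \<le> \<epsilon> * (\<eta> / 4)" using \<epsilon> by (intro mult_left_mono) auto
    have \<epsilon>\<eta>: "\<epsilon> * \<eta> \<le> \<eta> / 2" using mult_right_mono [OF \<epsilon>(4), of \<eta>] \<eta> by simp
    have "\<bar>r\<bar> \<le> cmod (cnj (f x) * g x)" unfolding r_def by (rule abs_Re_le_cmod)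
    also have "\<dots> \<le> M * B"
      using B f that \<open>M > 0\<close> by (auto simp: norm_mult intro!: mult_mono)
    finally have "\<epsilon> * (- r) \<le> \<epsilon> * (M * B)" using \<epsilon>(1) by (intro mult_left_mono) auto
    then have rle: "- (\<epsilon> * r) \<le> \<eta> / 8" using \<epsilon>(3) by simp
    have "\<eta> \<le> h x" using x0(2) [OF that] by (simp add: \<eta>_def)
    then consider "\<eta> \<le> M\<^sup>2 - (cmod (f x))\<^sup>2" | "\<eta> \<le> r"
      unfolding h_def r_def by linarith
    then show ?thesis
    proof cases
      case 1
      then show ?thesis unfolding expand using small \<epsilon>\<eta> rle \<eta> by linarith
    next
      case 2
      then have "\<epsilon> * \<eta> \<le> \<epsilon> * r" using \<epsilon>(1) by (intro mult_left_mono) auto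
      moreover have "\<epsilon> * (\<eta> / 4) \<le> \<epsilon> * \<eta>" using \<epsilon>(1) \<eta> by simp
      ultimately show ?thesis unfolding expand using small f2 by linarith
    qed
  qed
  \<comment> \<open>Subtracting only half of the gain leaves strict inequalities on both sides of
    \<open>s\<close>.\<close>
  define s where "s = sqrt (M\<^sup>2 - \<epsilon> * \<eta> / 2)"
  have "0 \<le> (cmod (f x0 - of_real \<epsilon> * g x0))\<^sup>2" by simp
  also note bound [OF x0(1)]
  finally have nonneg: "0 \<le> M\<^sup>2 - \<epsilon> * \<eta>" .
  have pos: "\<epsilon> * \<eta> > 0" using \<epsilon> \<eta> by simp
  show ?thesis
  proof (rule that [of s \<epsilon>])
    show "0 < s" using nonneg pos by (simp add: s_def)
    show "s < M" using pos \<open>M > 0\<close> unfolding s_def by (intro real_less_lsqrt) auto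
    show "cmod (f x - of_real \<epsilon> * g x) < s" if "x \<in> K" for x
      using bound [OF that] pos unfolding s_def by (intro real_less_rsqrt) auto
  qed
qed

text \<open>The perturbation argument on the closed polydisc with \<open>M = n\<close>;
  non-divisibility supplies the positive correlation at the maximum points.\<close>

lemma improved_power_sum_bound:
  assumes "1 \<le> k" "\<not> k dvd CARD('n::{finite,linorder})"
  obtains \<epsilon> s :: real where "0 < s" "s < CARD('n::{finite,linorder})"
    "\<And>z :: complex ^ 'n::{finite,linorder}. \<forall>i. cmod (z $ i) \<le> 1 \<Longrightarrow>
      cmod ((\<Sum>i\<in>UNIV. (- z $ i) ^ k) -
        of_real \<epsilon> * (\<Sum>j\<in>{1..<k}. (\<Sum>i\<in>UNIV. (- z $ i) ^ j) * (\<Sum>i\<in>UNIV. (- z $ i) ^ (k - j)))) < s"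
proof -
  let ?K = "{z :: complex ^ 'n::{finite,linorder}. \<forall>i. cmod (z $ i) \<le> 1}"
  let ?p = "\<lambda>j (z :: complex ^ 'n::{finite,linorder}). \<Sum>i\<in>UNIV. (- z $ i) ^ j"
  let ?q = "\<lambda>z. \<Sum>j\<in>{1..<k}. ?p j z * ?p (k - j) z"
  obtain \<epsilon> s where "0 < s" "s < real CARD('n)" "\<And>z. z \<in> ?K \<Longrightarrow> cmod (?p k z - of_real \<epsilon> * ?q z) < s"
  proof (rule perturbation_decreases_norm [of ?K "?p k" ?q "real CARD('n)"])
    show "compact ?K" by (rule compact_closed_polydisc)
    show "continuous_on ?K (?p k)" "continuous_on ?K ?q" by (intro continuous_intros)+
    show "real CARD('n) > 0" by simp
    show "cmod (?p k z) \<le> real CARD('n)" if "z \<in> ?K" for z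
    proof -
      have "cmod (?p k z) \<le> (\<Sum>i\<in>(UNIV :: 'n set). 1)"
        using that by (intro sum_norm_le) (auto simp: norm_power power_le_one)
      then show ?thesis by simp
    qed
    show "Re (cnj (?p k z) * ?q z) > 0" if "z \<in> ?K" "cmod (?p k z) = real CARD('n)" for z
      using psum_correlation_pos [of UNIV k "\<lambda>i. - z $ i"] that assms by auto
  qed auto
  then show thesis using that by auto
qed

section \<open>The value of \<open>rho\<close> and bounds on the maps \<open>f_map\<close>\<close>

text \<open>A single term of the sum survives, and its modulus is constant on the unit
  circle.\<close>

lemma rho_std_basis:
  assumes "1 \<le> k" "k \<le> CARD('n::{finite,linorder})"
  shows "rho (std_basis k :: complex ^ 'n::{finite,linorder}) = k / CARD('n::{finite,linorder})"
proof -
  have c: "coord (std_basis k :: complex ^ 'n::{finite,linorder}) j = (if j = k then 1 else 0)" if "j \<in> {1..CARD('n)}" for j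
  proof -
    have "(idx j :: 'n) = idx k \<longleftrightarrow> j = k"
      using that assms pos_idx [where 'n = 'n] by (metis atLeastAtMost_iff)
    then show ?thesis using that by (auto simp: coord_def std_basis_def axis_def)
  qed
  have "(\<Sum>j=1..CARD('n). of_nat j * coord (std_basis k :: complex ^ 'n::{finite,linorder}) j * l ^ (j - 1)) = of_nat k * l ^ (k - 1)" for l
  proof -
    have "(\<Sum>j=1..CARD('n). of_nat j * coord (std_basis k :: complex ^ 'n::{finite,linorder}) j * l ^ (j - 1)) =
      (\<Sum>j=1..CARD('n). if j = k then of_nat k * l ^ (k - 1) else 0)"
      by (intro sum.cong refl) (subst c, auto)
    then show ?thesis using assms by simp
  qed
  then have "rho (std_basis k :: complex ^ 'n::{finite,linorder}) = (SUP l \<in> sphere (0::complex) 1. k / CARD('n))"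
    unfolding rho_def by (intro arg_cong [where f = Sup] image_cong refl) (simp add: norm_mult norm_divide norm_power)
  also have "\<dots> = k / CARD('n)"
    by (rule cSUP_const) (auto intro: exI [of _ 1])
  finally show ?thesis .
qed

lemma coord_std_basis:
  assumes "1 \<le> k" "k \<le> CARD('n::{finite,linorder})"
  shows "coord (std_basis k :: complex ^ 'n::{finite,linorder}) k = 1"
  using assms by (simp add: coord_def std_basis_def)

text \<open>
  These weights are chosen so that \<open>p_map\<close> lowers the reciprocal of the norm by at most one at each
  step, and so that the bound on \<open>a e\<^sub>k\<close> is \<open>(k / n) \<bar>a\<bar>\<close> to first order.
\<close>

definition weighted_norm :: "nat \<Rightarrow> (nat \<Rightarrow> complex) \<Rightarrow> real" where
  "weighted_norm m z = (\<Sum>j=1..m. j * cmod (z j)) / m"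

text \<open>The coefficient of \<open>a j\<close> collects \<open>j * (c - j)\<close> and, from the
  preceding summand, \<open>(j - 1) * j\<close>; together these are
  \<open>(c - 1) * j\<close>.\<close>

lemma sum_telescoping_weights:
  fixes a :: "nat \<Rightarrow> real"
  shows "(\<Sum>j=1..q. real j * ((c - real j) * a j + (real j + 1) * a (Suc j))) =
    (c - 1) * (\<Sum>j=1..q. real j * a j) + real q * (real q + 1) * a (Suc q)"
  by (induction q) (simp_all add: algebra_simps)

text \<open>In the weighted sum the numerators reproduce the old sum up to the factor
  \<open>m - 1\<close>. The denominators cost at most \<open>1 - N\<close> relative to
  \<open>m\<close>, because the summand \<open>j = 1\<close> alone gives
  \<open>cmod (z 1) \<le> m * N\<close>.\<close>

lemma weighted_norm_p_map:
  assumes "m \<ge> 2" "cmod l = 1" "weighted_norm m z < 1"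
  shows "weighted_norm (m - 1) (p_map m l z) \<le> weighted_norm m z / (1 - weighted_norm m z)"
proof -
  define N where "N = weighted_norm m z"
  obtain q where q: "m = Suc q" "q \<ge> 1" using assms(1) by (cases m) auto
  let ?S = "\<Sum>j=1..m. real j * cmod (z j)"
  have S: "?S = m * N" using q by (simp add: N_def weighted_norm_def)
  have "real 1 * cmod (z 1) \<le> ?S"
    by (rule member_le_sum) (use q in auto)
  then have "cmod (l * z 1) \<le> m * N" using S assms(2) by (simp add: norm_mult)
  then have den: "cmod (of_nat m + l * z 1) \<ge> m * (1 - N)"
    using norm_diff_ineq [of "of_nat m" "l * z 1"] by (simp add: algebra_simps)
  have pos: "m * (1 - N) > 0" using assms by (simp add: N_def)
  have "real j * cmod (p_map m l z j) \<le>
      real j * ((real m - real j) * cmod (z j) + (real j + 1) * cmod (z (Suc j))) / (m * (1 - N))"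
    if "j \<in> {1..q}" for j
  proof -
    have "cmod (of_nat (m - j) * z j + l * of_nat (j + 1) * z (j + 1)) \<le>
        cmod (of_nat (m - j) * z j) + cmod (l * of_nat (j + 1) * z (j + 1))"
      by (rule norm_triangle_ineq)
    also have "cmod (of_nat (m - j) * z j) = (real m - real j) * cmod (z j)"
      unfolding norm_mult norm_of_nat using that q by (simp add: of_nat_diff)
    also have "cmod (l * of_nat (j + 1) * z (j + 1)) = (real j + 1) * cmod (z (Suc j))"
      unfolding norm_mult norm_of_nat using assms(2) by simp
    finally have "cmod (p_map m l z j) \<le>
        ((real m - real j) * cmod (z j) + (real j + 1) * cmod (z (Suc j))) / (m * (1 - N))"
      using that q den pos unfolding p_map_def by (auto simp: norm_divide intro!: frac_le)
    then have "real j * cmod (p_map m l z j) \<le>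
        real j * (((real m - real j) * cmod (z j) + (real j + 1) * cmod (z (Suc j))) / (m * (1 - N)))"
      by (intro mult_left_mono) auto
    then show ?thesis by simp
  qed
  then have "(\<Sum>j=1..q. real j * cmod (p_map m l z j)) \<le>
     (\<Sum>j=1..q. real j * ((real m - real j) * cmod (z j) + (real j + 1) * cmod (z (Suc j))) / (m * (1 - N)))"
    by (intro sum_mono) auto
  also have "\<dots> = (\<Sum>j=1..q. real j * ((real m - real j) * cmod (z j) + (real j + 1) * cmod (z (Suc j)))) / (m * (1 - N))"
    by (simp add: sum_divide_distrib)
  \<comment> \<open>For \<open>c = m = q + 1\<close> the boundary term is \<open>q\<close> times the
    missing summand \<open>j = m\<close> of \<open>?S\<close>.\<close>
  also have "(\<Sum>j=1..q. real j * ((real m - real j) * cmod (z j) + (real j + 1) * cmod (z (Suc j)))) = real q * ?S"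
    by (rule trans [OF sum_telescoping_weights]) (simp add: q algebra_simps)
  also have "real q * ?S / (m * (1 - N)) = q * (N / (1 - N))"
    unfolding S using pos \<open>m \<ge> 2\<close> by simp
  finally have le: "(\<Sum>j=1..q. real j * cmod (p_map m l z j)) \<le> q * (N / (1 - N))" .
  have "weighted_norm (m - 1) (p_map m l z) = (\<Sum>j=1..q. real j * cmod (p_map m l z j)) / q"
    by (simp add: weighted_norm_def q(1))
  also have "\<dots> \<le> N / (1 - N)"
    using le q(2) by (simp add: pos_divide_le_eq mult.commute)
  finally show ?thesis by (simp only: N_def)
qed

lemma weighted_norm_nonneg: "weighted_norm m z \<ge> 0"
  by (simp add: weighted_norm_def sum_nonneg)

text \<open>The map \<open>N \<mapsto> N / (1 - N)\<close> lowers \<open>1 / N\<close> by one, so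
  \<open>r\<close> iterations give \<open>N / (1 - r * N)\<close>.\<close>

lemma norm_p_comp_le:
  assumes "\<And>i. i \<in> {1..r} \<Longrightarrow> cmod (l i) = 1" "r * weighted_norm (r + 1) z < 1"
  shows "cmod (p_comp l r z 1) \<le> weighted_norm (r + 1) z / (1 - r * weighted_norm (r + 1) z)"
  using assms
proof (induction r arbitrary: z)
  case 0
  then show ?case by (simp add: weighted_norm_def)
next
  case (Suc r)
  let ?z = "p_map (r + 2) (l (Suc r)) z"
  define N where "N = weighted_norm (r + 2) z"
  define N' where "N' = weighted_norm (r + 1) ?z"
  have N: "N \<ge> 0" "N' \<ge> 0" by (simp_all add: N_def N'_def weighted_norm_nonneg)
  have rN: "r * N + N < 1" using Suc.prems(2) by (simp add: N_def algebra_simps)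
  then have N1: "N < 1" using N by (smt (verit) mult_nonneg_nonneg of_nat_0_le_iff)
  have N': "N' \<le> N / (1 - N)"
    using weighted_norm_p_map [of "r + 2" "l (Suc r)" z] Suc.prems N1 by (simp add: N_def N'_def)
  then have "r * N' \<le> r * (N / (1 - N))" by (intro mult_left_mono) auto
  also have "\<dots> < 1" using rN N1 by (simp add: field_simps)
  finally have rN': "r * N' < 1" .
  have "cmod (p_comp l (Suc r) z 1) \<le> N' / (1 - r * N')"
    using Suc.IH [of ?z] Suc.prems rN' by (simp add: N'_def)
  also have "\<dots> \<le> (N / (1 - N)) / (1 - r * (N / (1 - N)))"
    using N' N N1 \<open>r * (N / (1 - N)) < 1\<close> \<open>r * N' \<le> _\<close> by (intro frac_le) auto
  also have "\<dots> = N / (1 - Suc r * N)"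
  proof -
    have "1 - r * (N / (1 - N)) = (1 - Suc r * N) / (1 - N)"
      using N1 by (simp add: field_simps)
    then show ?thesis unfolding \<open>1 - r * (N / (1 - N)) = _\<close> using N1 by simp
  qed
  finally show ?case by (simp add: N_def)
qed

lemma norm_f_map_le:
  fixes w :: "complex ^ 'n::{finite,linorder}"
  defines "N \<equiv> weighted_norm CARD('n::{finite,linorder}) (coord w)"
  assumes "l \<in> {1..CARD('n::{finite,linorder}) - 1} \<rightarrow>\<^sub>E sphere 0 1" "real (CARD('n::{finite,linorder}) - 1) * N < 1"
  shows "cmod (f_map l w) \<le> N / (1 - real (CARD('n::{finite,linorder}) - 1) * N)"
proof -
  have "CARD('n) - 1 + 1 = CARD('n)" by (simp add: Suc_leI)
  then show ?thesis
    using norm_p_comp_le [of "CARD('n) - 1" l "coord w"] assms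
    by (force simp: f_map_def PiE_iff)
qed

lemma artanh_strict_mono:
  fixes x y :: real
  assumes "- 1 < x" "x < y" "y < 1"
  shows "artanh x < artanh y"
  using assms unfolding artanh_def by (simp add: field_simps)

lemma artanh_mono:
  fixes x y :: real
  assumes "- 1 < x" "x \<le> y" "y < 1"
  shows "artanh x \<le> artanh y"
  using artanh_strict_mono [of x y] assms by (cases "x = y") auto

lemma p_dist_0_le:
  fixes w :: "complex ^ 'n::{finite,linorder}"
  defines "N \<equiv> weighted_norm CARD('n::{finite,linorder}) (coord w)"
  assumes "real (CARD('n::{finite,linorder}) - 1) * N < 1" "N / (1 - real (CARD('n::{finite,linorder}) - 1) * N) < 1"
  shows "p_dist 0 w \<le> artanh (N / (1 - real (CARD('n::{finite,linorder}) - 1) * N))"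
  unfolding p_dist_def
proof (rule cSUP_least)
  show "({1..CARD('n) - 1} \<rightarrow>\<^sub>E sphere (0::complex) 1) \<noteq> {}"
    by (auto simp: PiE_eq_empty_iff intro: exI [of _ 1])
  fix l :: "nat \<Rightarrow> complex" assume l: "l \<in> {1..CARD('n) - 1} \<rightarrow>\<^sub>E sphere 0 1"
  \<comment> \<open>At the origin the bound itself is 0, which forces \<open>f_map l 0 = 0\<close>;
    the Poincare distance is then \<open>artanh\<close> of a modulus.\<close>
  have "weighted_norm CARD('n) (coord (0 :: complex ^ 'n::{finite,linorder})) = 0"
    by (simp add: weighted_norm_def coord_def)
  then have "f_map l (0 :: complex ^ 'n::{finite,linorder}) = 0"
    using norm_f_map_le [of l "0 :: complex ^ 'n::{finite,linorder}"] l by simp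
  moreover have "cmod (f_map l w) \<le> N / (1 - real (CARD('n) - 1) * N)"
    using norm_f_map_le [of l w] l assms by simp
  then have "artanh (cmod (f_map l w)) \<le> artanh (N / (1 - real (CARD('n) - 1) * N))"
    using assms by (intro artanh_mono less_le_trans [of "- 1" 0 "cmod (f_map l w)"]) auto
  ultimately show "poincare_dist (f_map l (0 :: complex ^ 'n::{finite,linorder})) (f_map l w)
      \<le> artanh (N / (1 - real (CARD('n) - 1) * N))"
    by (simp add: poincare_dist_def)
qed

section \<open>Test points on the coordinate axes\<close>

text \<open>The first \<open>k\<close> coordinates of \<open>- z\<close> are the roots of
  \<open>X^k - t^k\<close> and the others are 0, so only the \<open>k\<close>-th elementary
  symmetric function survives.\<close>

lemma roots_of_unity_point:
  assumes k: "1 \<le> k" "k \<le> CARD('n::{finite,linorder})" and t: "0 < t" "t < 1"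
  obtains z :: "complex ^ 'n::{finite,linorder}" where "z \<in> polydisc"
    "\<forall>j\<in>{1..<k}. (\<Sum>i\<in>UNIV. (- z $ i) ^ j) = 0"
    "(\<Sum>i\<in>UNIV. (- z $ i) ^ k) = of_nat k * of_real t ^ k"
    "\<forall>j. j \<noteq> k \<longrightarrow> coord (symmetrization z) j = 0"
    "cmod (coord (symmetrization z) k) = t ^ k"
proof -
  define \<omega> where "\<omega> = exp (2 * of_real pi * \<i> * of_nat 1 / of_nat k)"
  have \<omega>_power: "\<omega> ^ j = exp (2 * of_real pi * \<i> * of_nat j / of_nat k)" for j
    by (simp add: \<omega>_def mult_ac flip: exp_of_nat_mult)
  have \<omega>_eq_1: "\<omega> ^ j = 1 \<longleftrightarrow> k dvd j" for j
    unfolding \<omega>_power using complex_root_unity_eq_1 [of k j] k by simp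
  have norm_\<omega>: "cmod \<omega> = 1"
    using k \<omega>_eq_1 [of k] by (metis dvd_refl power_eq_1_iff not_one_le_zero)
  define x where "x m = (if m \<le> k then of_real t * \<omega> ^ m else 0)" for m
  define z :: "complex ^ 'n::{finite,linorder}" where "z = (\<chi> i. - x (pos i))"
  have norm_x: "cmod (x m) < 1" for m
    using t by (simp add: x_def norm_mult norm_power norm_\<omega>)
  then have z: "z \<in> polydisc" by (simp add: polydisc_def z_def)
  have psum: "(\<Sum>i\<in>UNIV. (- z $ i) ^ j) = of_real t ^ j * (\<Sum>m=1..k. (\<omega> ^ j) ^ m)" if "j \<ge> 1" for j
  proof -
    have "(\<Sum>i\<in>UNIV. (- z $ i) ^ j) = (\<Sum>m\<in>{1..CARD('n)}. x m ^ j)"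
      using sum.reindex_bij_betw [OF bij_betw_pos, of "\<lambda>m. x m ^ j"] by (simp add: z_def)
    also have "\<dots> = (\<Sum>m=1..k. x m ^ j)"
      using k that by (intro sum.mono_neutral_right) (auto simp: x_def)
    also have "\<dots> = (\<Sum>m=1..k. of_real t ^ j * (\<omega> ^ j) ^ m)"
      by (intro sum.cong refl) (simp add: x_def power_mult_distrib flip: power_mult, simp add: mult.commute)
    finally show ?thesis by (simp add: sum_distrib_left)
  qed
  have psum_0: "(\<Sum>i\<in>UNIV. (- z $ i) ^ j) = 0" if "j \<in> {1..<k}" for j
  proof -
    have "\<omega> ^ j \<noteq> 1" using that by (auto simp: \<omega>_eq_1 dest: dvd_imp_le)
    moreover have "(\<omega> ^ j) ^ k = 1" using \<omega>_eq_1 [of "j * k"] by (simp add: power_mult)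
    ultimately have "(\<Sum>m<k. (\<omega> ^ j) ^ m) = 0" by (simp add: geometric_sum)
    moreover have "(\<Sum>m=1..k. (\<omega> ^ j) ^ m) = (\<Sum>m<k. \<omega> ^ j * (\<omega> ^ j) ^ m)"
      by (rule sum.reindex_bij_witness [of _ Suc "\<lambda>m. m - 1"]) (auto simp flip: power_Suc)
    ultimately show ?thesis using psum that by (simp flip: sum_distrib_left)
  qed
  have psum_k: "(\<Sum>i\<in>UNIV. (- z $ i) ^ k) = of_nat k * of_real t ^ k"
    using psum [OF k(1)] \<omega>_eq_1 [of k] by (simp add: mult.commute)
  let ?w = "coord (symmetrization z)"
  \<comment> \<open>Vanishing power sums below \<open>k\<close> make Newton's recursion yield
    vanishing elementary symmetric functions.\<close>
  have below: "?w j = 0" if "j < k" for j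
    using that
  proof (induction j rule: less_induct)
    case (less j)
    show ?case
    proof (cases "j = 0")
      case False
      then have "0 = newton_psum ?w j"
        using newton_psum_symmetrization [of j z] psum_0 [of j] less.prems k by simp
      also have "\<dots> = - of_nat j * ?w j"
        using less by (subst newton_psum.simps) simp
      finally show ?thesis using False by simp
    qed (simp add: coord_def)
  qed
  have "newton_psum ?w k = - of_nat k * ?w k"
    using below by (subst newton_psum.simps) simp
  then have "?w k = - (of_real t ^ k)"
    using newton_psum_symmetrization [of k z] psum_k k
      mult_left_cancel [of "of_nat k" "?w k" "- (of_real t ^ k)"] by (simp add: minus_equation_iff)
  then have at_k: "cmod (?w k) = t ^ k" using t by (simp add: norm_power)
  \<comment> \<open>A product of more than \<open>k\<close> coordinates contains a zero one.\<close>
  have above: "?w j = 0" if "j > k" for j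
  proof (cases "j \<le> CARD('n)")
    case True
    have "(\<Prod>i\<in>S. z $ i) = 0" if S: "card S = j" for S
    proof -
      have "card {i :: 'n. pos i \<in> {1..k}} \<le> card {1..k}"
        by (intro card_inj_on_le [of pos]) (auto intro: inj_on_subset [OF inj_pos])
      moreover have "card S \<le> card {i :: 'n. pos i \<in> {1..k}}" if "S \<subseteq> {i. pos i \<in> {1..k}}"
        using that by (intro card_mono) auto
      ultimately obtain i where "i \<in> S" "pos i \<notin> {1..k}"
        using S \<open>j > k\<close> by fastforce
      moreover have "pos i \<ge> 1" using bij_betwE [OF bij_betw_pos] by (metis UNIV_I atLeastAtMost_iff)
      ultimately show ?thesis by (intro prod_zero bexI [of _ i]) (auto simp: z_def x_def)
    qed
    then have "(\<Sum>S | card S = j. \<Prod>i\<in>S. z $ i) = 0" by (intro sum.neutral) simp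
    then show ?thesis using True \<open>j > k\<close> k(1) by (subst coord_symmetrization) auto
  qed (simp add: coord_def)
  show thesis
    by (rule that [OF z _ psum_k _ at_k]) (use psum_0 below above in \<open>auto simp: neq_iff\<close>)
qed

section \<open>The competing function and the two strict inequalities\<close>

text \<open>The quadratic correction affects neither the derivative at 0 nor the values where the
  lower power sums vanish. The same \<open>f\<close> therefore serves both the metric and the
  distance.\<close>

lemma improved_power_sum_function:
  assumes k: "1 \<le> k" "k \<le> CARD('n::{finite,linorder})" "\<not> k dvd CARD('n::{finite,linorder})"
  obtains f and s :: real where "0 < s" "s < CARD('n::{finite,linorder})"
    "f \<in> holomorphic_maps (symdisc :: (complex ^ 'n::{finite,linorder}) set) (ball 0 1)" "f 0 = 0"
    "frechet_derivative f (at 0) = (\<lambda>v. - of_nat k * coord v k / of_real s)"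
    "\<forall>z. (\<forall>j\<in>{1..<k}. (\<Sum>i\<in>UNIV. (- z $ i) ^ j) = 0) \<longrightarrow>
      f (symmetrization z) = (\<Sum>i\<in>UNIV. (- z $ i) ^ k) / of_real s"
proof -
  obtain \<epsilon> s :: real where s: "0 < s" "s < CARD('n)" and bound:
    "\<And>z :: complex ^ 'n::{finite,linorder}. \<forall>i. cmod (z $ i) \<le> 1 \<Longrightarrow>
      cmod ((\<Sum>i\<in>UNIV. (- z $ i) ^ k) -
        of_real \<epsilon> * (\<Sum>j\<in>{1..<k}. (\<Sum>i\<in>UNIV. (- z $ i) ^ j) * (\<Sum>i\<in>UNIV. (- z $ i) ^ (k - j)))) < s"
    by (rule improved_power_sum_bound [OF k(1,3)]) (rule that)
  define P where "P j w = newton_psum (coord w) j" for j and w :: "complex ^ 'n::{finite,linorder}"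
  define f where "f w = (P k w - of_real \<epsilon> * (\<Sum>j\<in>{1..<k}. P j w * P (k - j) w)) * (1 / of_real s)" for w
  have P_sym: "P j (symmetrization z) = (\<Sum>i\<in>UNIV. (- z $ i) ^ j)" if "0 < j" "j \<le> k" for j z
    using that k by (simp add: P_def newton_psum_symmetrization)
  have f_sym: "f (symmetrization z) = ((\<Sum>i\<in>UNIV. (- z $ i) ^ k) - of_real \<epsilon> *
      (\<Sum>j\<in>{1..<k}. (\<Sum>i\<in>UNIV. (- z $ i) ^ j) * (\<Sum>i\<in>UNIV. (- z $ i) ^ (k - j)))) / of_real s" for z
    using k unfolding f_def by (simp add: P_sym)
  have maps: "f w \<in> ball 0 1" if "w \<in> symdisc" for w
  proof -
    obtain z where z: "w = symmetrization z" "z \<in> polydisc" using \<open>w \<in> symdisc\<close> by (auto simp: symdisc_def)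
    then have "\<forall>i. cmod (z $ i) \<le> 1" by (auto simp: polydisc_def less_imp_le)
    from bound [OF this] s show ?thesis
      by (simp add: z f_sym norm_divide)
  qed
  have "complex_differentiable f w" for w
    unfolding f_def P_def
    by (intro complex_differentiable_diff complex_differentiable_sum complex_differentiable_mult
        complex_differentiable_const complex_differentiable_newton_psum)
  with maps have hol: "f \<in> holomorphic_maps symdisc (ball 0 1)"
    by (auto simp: holomorphic_maps_def complex_differentiable_def)
  have P0: "P j 0 = 0" for j by (simp add: P_def newton_psum_coord_0)
  have dP: "(P j has_derivative (\<lambda>v. - of_nat j * coord v j)) (at 0)" for j
    using has_derivative_newton_psum_0 [where 'n = 'n] by (simp add: P_def [abs_def])
  have "((\<lambda>w. \<Sum>j\<in>{1..<k}. P j w * P (k - j) w) has_derivative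
      (\<lambda>v. \<Sum>j\<in>{1..<k}. P j 0 * (- of_nat (k - j) * coord v (k - j)) + (- of_nat j * coord v j) * P (k - j) 0)) (at 0)"
    by (rule has_derivative_sum) (rule has_derivative_mult [OF dP dP])
  then have dQ: "((\<lambda>w. \<Sum>j\<in>{1..<k}. P j w * P (k - j) w) has_derivative (\<lambda>v. 0)) (at 0)"
    by (simp only: P0 mult_zero_left mult_zero_right add_0 sum.neutral_const)
  have "(f has_derivative (\<lambda>v. (- of_nat k * coord v k - of_real \<epsilon> * 0) * (1 / of_real s))) (at 0)"
    unfolding f_def by (rule has_derivative_mult_left [OF has_derivative_diff [OF dP has_derivative_mult_right [OF dQ]]])
  from frechet_derivative_at [OF this]
  have "frechet_derivative f (at 0) = (\<lambda>v. - of_nat k * coord v k / of_real s)"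
    by simp
  then show thesis
    using that [of s f] s hol P0 f_sym by (auto simp: f_def)
qed

lemma rho_less_caratheodory_reiffen:
  assumes k: "1 \<le> k" "k \<le> CARD('n::{finite,linorder})" "\<not> k dvd CARD('n::{finite,linorder})"
  shows "ereal (rho (std_basis k :: complex ^ 'n::{finite,linorder})) < caratheodory_reiffen symdisc 0 (std_basis k :: complex ^ 'n::{finite,linorder})"
proof -
  obtain f and s :: real where f: "0 < s" "s < CARD('n)"
    "f \<in> holomorphic_maps (symdisc :: (complex ^ 'n::{finite,linorder}) set) (ball 0 1)" "f 0 = 0"
    "frechet_derivative f (at 0) = (\<lambda>v. - of_nat k * coord v k / of_real s)"
    by (rule improved_power_sum_function [OF k]) (rule that)
  have "rho (std_basis k :: complex ^ 'n::{finite,linorder}) = k / CARD('n)" by (rule rho_std_basis [OF k(1,2)])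
  also have "\<dots> < k / s" using f k by (intro divide_strict_left_mono) auto
  also have "\<dots> = cmod (frechet_derivative f (at 0) (std_basis k))"
    using f k by (simp add: coord_std_basis norm_divide norm_mult)
  finally have "ereal (rho (std_basis k :: complex ^ 'n::{finite,linorder})) < ereal (cmod (frechet_derivative f (at 0) (std_basis k)))"
    by simp
  also have "\<dots> \<le> caratheodory_reiffen symdisc 0 (std_basis k :: complex ^ 'n::{finite,linorder})"
    unfolding caratheodory_reiffen_def by (rule SUP_upper) (use f in auto)
  finally show ?thesis .
qed

lemma p_dist_less_caratheodory_dist:
  assumes k: "1 \<le> k" "k \<le> CARD('n::{finite,linorder})" "\<not> k dvd CARD('n::{finite,linorder})"
  obtains w :: "complex ^ 'n::{finite,linorder}" where "w \<in> symdisc" "ereal (p_dist 0 w) < caratheodory_dist symdisc 0 w"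
proof -
  obtain f and s :: real where s: "0 < s" "s < CARD('n)" and f:
    "f \<in> holomorphic_maps (symdisc :: (complex ^ 'n::{finite,linorder}) set) (ball 0 1)" "f 0 = 0"
    "\<forall>z. (\<forall>j\<in>{1..<k}. (\<Sum>i\<in>UNIV. (- z $ i) ^ j) = 0) \<longrightarrow>
      f (symmetrization z) = (\<Sum>i\<in>UNIV. (- z $ i) ^ k) / of_real s"
    by (rule improved_power_sum_function [OF k]) (rule that)
  define n where "n = real CARD('n)"
  \<comment> \<open>This choice gives \<open>k * t = (n - s) / n\<close>. With
    \<open>a = k * t ^ k \<le> k * t\<close> it ensures \<open>(n - 1) * a < n - s\<close>, which
    makes the bound on \<open>f_map\<close> smaller than \<open>a / s\<close>.\<close>
  define t where "t = (n - s) / (n * k)"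
  have n: "n \<ge> 1" "s < n" "n > 0" using s by (auto simp: n_def Suc_leI)
  have "n * 1 \<le> n * k" using k n by (intro mult_left_mono) auto
  then have "n - s < n * k" using s by linarith
  then have t: "0 < t" "t < 1" using n k by (simp_all add: t_def)
  obtain z :: "complex ^ 'n::{finite,linorder}" where z: "z \<in> polydisc"
    "\<forall>j\<in>{1..<k}. (\<Sum>i\<in>UNIV. (- z $ i) ^ j) = 0"
    "(\<Sum>i\<in>UNIV. (- z $ i) ^ k) = of_nat k * of_real t ^ k"
    "\<forall>j. j \<noteq> k \<longrightarrow> coord (symmetrization z) j = 0"
    "cmod (coord (symmetrization z) k) = t ^ k"
    by (rule roots_of_unity_point [OF k(1,2) t]) (rule that)
  define w where "w = symmetrization z"
  have w: "w \<in> symdisc" using z(1) by (auto simp: w_def symdisc_def)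
  define a where "a = k * t ^ k"
  have a: "a > 0" using t k by (simp add: a_def)
  have fw: "cmod (f w) = a / s"
    using f(3) z(2,3) t s by (simp add: w_def a_def norm_divide norm_mult norm_power)
  have "(\<Sum>j=1..CARD('n). j * cmod (coord w j)) = (\<Sum>j=1..CARD('n). if j = k then a else 0)"
    by (intro sum.cong) (auto simp: w_def z a_def)
  then have N: "weighted_norm CARD('n) (coord w) = a / n"
    using k by (simp add: weighted_norm_def n_def)
  have "t ^ k \<le> t ^ 1" using t k by (intro power_decreasing) auto
  then have "a \<le> k * t" unfolding a_def by (intro mult_left_mono) auto
  then have "(n - 1) * a \<le> (n - 1) * (k * t)" using n by (intro mult_left_mono) auto
  also have "\<dots> = (n - 1) * ((n - s) / n)" using k n by (simp add: t_def)
  also have "\<dots> < n - s" using n s by (simp add: field_simps)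
  finally have na: "s < n - (n - 1) * a" by simp
  have n1: "real (CARD('n) - 1) = n - 1" by (simp add: n_def of_nat_diff Suc_leI)
  have less: "(a / n) / (1 - (n - 1) * (a / n)) < a / s"
  proof -
    have "(a / n) / (1 - (n - 1) * (a / n)) = a / (n - (n - 1) * a)"
      using n na s by (simp add: field_simps)
    also have "\<dots> < a / s" using a s na by (intro divide_strict_left_mono) auto
    finally show ?thesis .
  qed
  have lt1: "(n - 1) * (a / n) < 1" using n na s by (simp add: field_simps)
  have fw1: "a / s < 1" using f(1) w fw by (auto simp: holomorphic_maps_def)
  have "p_dist 0 w \<le> artanh ((a / n) / (1 - (n - 1) * (a / n)))"
    using p_dist_0_le [of w, unfolded N n1] lt1 less_trans [OF less fw1] by blast
  also have "\<dots> < artanh (cmod (f w))"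
    unfolding fw
  proof (rule artanh_strict_mono)
    have "0 \<le> (a / n) / (1 - (n - 1) * (a / n))"
      using a n lt1 by (intro divide_nonneg_nonneg) linarith+
    then show "- 1 < (a / n) / (1 - (n - 1) * (a / n))" by linarith
  qed (fact less fw1)+
  finally have "ereal (p_dist 0 w) < ereal (artanh (cmod (f w)))" by simp
  also have "\<dots> \<le> caratheodory_dist symdisc 0 w"
    unfolding caratheodory_dist_def by (rule SUP_upper) (use f in auto)
  finally show thesis using that w by blast
qed

theorem proposition2:
  assumes "CARD('n::{finite,linorder}) \<ge> 3"
  shows "(\<forall>k. 1 \<le> k \<and> k \<le> CARD('n) \<and> \<not> k dvd CARD('n) \<longrightarrow>
            caratheodory_reiffen (symdisc :: (complex ^ 'n::{finite,linorder}) set) 0 (std_basis k)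
              > ereal (rho (std_basis k :: complex ^ 'n::{finite,linorder}))) \<and>
         (\<exists>w \<in> (symdisc :: (complex ^ 'n::{finite,linorder}) set).
            caratheodory_dist (symdisc :: (complex ^ 'n::{finite,linorder}) set) 0 w \<noteq> ereal (p_dist 0 w))"
proof (intro conjI allI impI)
  fix k assume "1 \<le> k \<and> k \<le> CARD('n) \<and> \<not> k dvd CARD('n)"
  then show "ereal (rho (std_basis k :: complex ^ 'n::{finite,linorder})) < caratheodory_reiffen symdisc 0 (std_basis k :: complex ^ 'n::{finite,linorder})"
    using rho_less_caratheodory_reiffen by blast
next
  \<comment> \<open>The second claim uses \<open>k = n - 1\<close>: dividing \<open>n\<close>, it
    would divide the difference 1, although it is at least 2.\<close>
  have not_dvd: "\<not> CARD('n) - 1 dvd CARD('n)"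
  proof
    assume "CARD('n) - 1 dvd CARD('n)"
    then have "CARD('n) - 1 dvd CARD('n) - (CARD('n) - 1)" by (rule dvd_diff_nat) simp
    then show False using assms by simp
  qed
  obtain w :: "complex ^ 'n::{finite,linorder}" where "w \<in> symdisc" "ereal (p_dist 0 w) < caratheodory_dist symdisc 0 w"
    by (rule p_dist_less_caratheodory_dist [OF _ _ not_dvd]) (use assms in simp_all)
  then show "\<exists>w \<in> (symdisc :: (complex ^ 'n::{finite,linorder}) set). caratheodory_dist symdisc 0 w \<noteq> ereal (p_dist 0 w)"
    by (metis less_irrefl)
qed

end
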